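(* Let $G$ and $H$ be graphs. If $G$ is 2-connected and quantum isomorphic to $H$, then $H$ is 2-connected.
   Context: All graphs are finite and simple. $\mathrm{Adj}(G)$ is the adjacency matrix. A graph is 2-connected if it is connected and for every vertex $v$ the graph $G\setminus\{v\}$ is connected and nonempty (so $K_2$ is 2-connected and $K_1$ is not). Quantum isomorphism: a magic unitary with coefficients in a (nonzero) unital $C^*$-algebra $X$ is a matrix $U=(u_{ij})_{i\in I,j\in J}$ with $I,J$ finite, $u_{ij}=u_{ij}^2=u_{ij}^*\in X$, and $\sum_{k\in I}u_{kj}=1=\sum_{k\in J}u_{ik}$ for all $i\in I,j\in J$. A quantum isomorphism from a graph $G$ to a graph $H$ with the same number of vertices is a magic unitary $U$ indexed by $V(H)\times V(G)$ with $U\,\mathrm{Adj}(G)=\mathrm{Adj}(H)\,U$. $G$ and $H$ are quantum isomorphic if such a $U$ exists over some nonzero unital $C^*$-algebra. *)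

theory Defs
  imports Complex_Main "Graph_Theory.Graph_Theory"
begin

text \<open>
  A nonzero unital C*-algebra. The class \<^class>\<open>real_normed_algebra_1\<close> supplies
  \<open>0 \<noteq> 1\<close>, submultiplicativity of the norm and \<open>norm 1 = 1\<close>; the last of these holds in every nonzero
  unital C*-algebra, by the C*-identity for \<open>1\<close>. The complex structure \<open>scaleC\<close> extends the real one;
  in particular \<open>scaleC 1 x = x\<close>.
\<close>

class unital_cstar_algebra = banach + real_normed_algebra_1 +
  fixes scaleC :: "complex \<Rightarrow> 'a \<Rightarrow> 'a"
    and star :: "'a \<Rightarrow> 'a"
  assumes scaleC_add_right: "scaleC c (x + y) = scaleC c x + scaleC c y"
    and scaleC_add_left: "scaleC (c + d) x = scaleC c x + scaleC d x"
    and scaleC_scaleC: "scaleC c (scaleC d x) = scaleC (c * d) x"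
    and scaleR_scaleC: "scaleR r x = scaleC (complex_of_real r) x"
    and mult_scaleC_left: "scaleC c x * y = scaleC c (x * y)"
    and mult_scaleC_right: "x * scaleC c y = scaleC c (x * y)"
    and norm_scaleC: "norm (scaleC c x) = cmod c * norm x"
    and star_star: "star (star x) = x"
    and star_add: "star (x + y) = star x + star y"
    and star_scaleC: "star (scaleC c x) = scaleC (cnj c) (star x)"
    and star_mult: "star (x * y) = star y * star x"
    and norm_star_mult: "norm (star x * x) = (norm x)\<^sup>2"

instantiation complex :: unital_cstar_algebra
begin

definition scaleC_complex :: "complex \<Rightarrow> complex \<Rightarrow> complex"
  where "scaleC_complex c x = c * x"

definition star_complex :: "complex \<Rightarrow> complex"
  where "star_complex x = cnj x"

instance
  by standard
    (simp_all add: scaleC_complex_def star_complex_def algebra_simps norm_mult power2_eq_square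
      scaleR_conv_of_real)

end

definition magic_unitary ::
    "'i set \<Rightarrow> 'j set \<Rightarrow> ('i \<Rightarrow> 'j \<Rightarrow> 'x::unital_cstar_algebra) \<Rightarrow> bool"
  where "magic_unitary I J u \<longleftrightarrow>
    finite I \<and> finite J \<and>
    (\<forall>i\<in>I. \<forall>j\<in>J. u i j * u i j = u i j \<and> star (u i j) = u i j) \<and>
    (\<forall>j\<in>J. (\<Sum>k\<in>I. u k j) = 1) \<and>
    (\<forall>i\<in>I. (\<Sum>k\<in>J. u i k) = 1)"

text \<open>
  A finite simple graph is a \<^locale>\<open>pair_graph\<close>: finitely many vertices, and a symmetric
  irreflexive set of arcs, each edge being represented by its two orientations.
\<close>

definition adj_matrix :: "'a pair_pre_digraph \<Rightarrow> 'a \<Rightarrow> 'a \<Rightarrow> 'x::unital_cstar_algebra"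
  where "adj_matrix G i j = (if (i, j) \<in> parcs G then 1 else 0)"

definition quantum_isomorphism ::
    "'a pair_pre_digraph \<Rightarrow> 'b pair_pre_digraph \<Rightarrow> ('b \<Rightarrow> 'a \<Rightarrow> 'x::unital_cstar_algebra) \<Rightarrow> bool"
  where "quantum_isomorphism G H u \<longleftrightarrow>
    card (pverts G) = card (pverts H) \<and>
    magic_unitary (pverts H) (pverts G) u \<and>
    (\<forall>i\<in>pverts H. \<forall>j\<in>pverts G.
      (\<Sum>k\<in>pverts G. u i k * adj_matrix G k j) = (\<Sum>k\<in>pverts H. adj_matrix H i k * u k j))"

text \<open>
  HOL cannot quantify over types inside a formula, so the algebra is a parameter. Two graphs are
  quantum isomorphic iff this predicate holds for some type; as a premise with a free type variable
  \<open>'x\<close> it therefore expresses quantum isomorphism over some nonzero unital C*-algebra.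
\<close>

definition quantum_isomorphic ::
    "'x::unital_cstar_algebra itself \<Rightarrow> 'a pair_pre_digraph \<Rightarrow> 'b pair_pre_digraph \<Rightarrow> bool"
  where "quantum_isomorphic X G H \<longleftrightarrow> (\<exists>u :: 'b \<Rightarrow> 'a \<Rightarrow> 'x. quantum_isomorphism G H u)"

text \<open>
  The library's \<^const>\<open>Digraph_Component.connected\<close> already requires a vertex, so the
  last conjunct is redundant; it excludes the one-vertex graph under either convention
  for the empty graph.
\<close>

definition two_connected :: "'a pair_pre_digraph \<Rightarrow> bool"
  where "two_connected G \<longleftrightarrow>
    Digraph_Component.connected (with_proj G) \<and>
    (\<forall>v\<in>pverts G.
      Digraph_Component.connected (pre_digraph.del_vert (with_proj G) v) \<and>
      verts (pre_digraph.del_vert (with_proj G) v) \<noteq> {})"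

end

theory Submission
  imports Defs
begin

text \<open>
  Let \<open>u\<close> be a quantum isomorphism, \<open>v\<close> a vertex of \<open>H\<close> and \<open>x\<close> a vertex of \<open>G\<close> with
  \<open>p = u v x \<noteq> 0\<close>. Since the entries of a row or column of \<open>u\<close> are mutually orthogonal, \<open>p * u\<close> is
  block diagonal with respect to the removal of \<open>x\<close> and \<open>v\<close>, and it intertwines the Laplacians of
  \<open>G - x\<close> and \<open>H - v\<close>. If \<open>C\<close> is a union of components of \<open>H - v\<close>, then
  \<open>z b = (\<Sum>a\<in>C. p * u a b)\<close> is therefore a harmonic function on the connected graph \<open>G - x\<close>, so it is
  constant. Summing \<open>z b * u e b * p\<close> over \<open>b\<close> shows that this constant satisfies \<open>z * p = p\<close> when
  \<open>e \<in> C\<close> and \<open>z * p = 0\<close> when \<open>e \<notin> C\<close>; as \<open>p \<noteq> 0\<close>, no vertex of \<open>H - v\<close> lies outside \<open>C\<close>.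
  Connectedness of \<open>H\<close> itself is the same argument with \<open>p = 1\<close>.
\<close>

section \<open>Projections and their norms in a C*-algebra\<close>

definition projection :: "'x::unital_cstar_algebra \<Rightarrow> bool"
  where "projection p \<longleftrightarrow> p * p = p \<and> star p = p"

lemma star_1 [simp]: "star (1 :: 'x::unital_cstar_algebra) = 1"
  by (metis mult_1_left star_mult star_star)

lemma star_scaleR: "star (r *\<^sub>R x) = r *\<^sub>R star (x :: 'x::unital_cstar_algebra)"
  by (simp add: scaleR_scaleC star_scaleC)

lemma star_0 [simp]: "star (0 :: 'x::unital_cstar_algebra) = 0"
  using star_scaleR[of 0 "0 :: 'x"] by simp

lemma star_minus: "star (- x) = - star (x :: 'x::unital_cstar_algebra)"
  using star_scaleR[of "-1" x] by simp

lemma star_diff: "star (x - y) = star x - star (y :: 'x::unital_cstar_algebra)"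
  using star_add[of x "- y"] by (simp add: star_minus)

lemma projection_1: "projection (1 :: 'x::unital_cstar_algebra)"
  by (simp add: projection_def)

lemma projection_compl: "projection p \<Longrightarrow> projection (1 - p)"
  by (simp add: projection_def star_diff algebra_simps)

lemma norm_projection_le_1:
  assumes "projection p"
  shows "norm p \<le> 1"
proof -
  have "norm p = (norm p)\<^sup>2"
    using norm_star_mult[of p] assms by (simp add: projection_def)
  then show ?thesis
    by (metis order_refl power2_eq_square mult_cancel_left1 zero_le_one)
qed

lemma norm_mult_projections_le_1:
  assumes "projection p" "projection q"
  shows "norm (p * q * p) \<le> 1"
proof -
  have "norm (p * q * p) \<le> norm p * norm q * norm p"
    by (meson mult_right_mono norm_ge_zero norm_mult_ineq order_trans)
  also have "\<dots> \<le> 1"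
    using assms by (intro mult_le_one) (auto simp: norm_projection_le_1)
  finally show ?thesis .
qed

lemma norm_mult_le_1:
  fixes x y :: "'x::real_normed_algebra"
  assumes "norm x \<le> 1" "norm y \<le> 1"
  shows "norm (x * y) \<le> 1"
  by (rule order_trans[OF norm_mult_ineq]) (simp add: assms mult_le_one)

section \<open>Extremality of a projection and orthogonality of projections with sum 1\<close>

text \<open>\<open>p + w + v\<close> is the mean of the squares of \<open>p + w\<close> and
  \<open>p + v\<close>: the squares of \<open>w\<close> and \<open>v\<close> cancel, and the unit
  ball is convex and closed under products.\<close>

lemma corner_ball_step:
  fixes p :: "'x::unital_cstar_algebra"
  assumes "p * p = p" "p * w = w" "w * p = w" "p * v = v" "v * p = v"
    and "v * v = - (w * w)" "norm (p + w) \<le> 1" "norm (p + v) \<le> 1"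
  shows "norm (p + (w + v)) \<le> 1"
proof -
  have "2 *\<^sub>R (p + (w + v)) = (p + w) * (p + w) + (p + v) * (p + v)"
    using assms(1-6) by (simp add: algebra_simps scaleR_2)
  then have "norm (2 *\<^sub>R (p + (w + v))) \<le> norm ((p + w) * (p + w)) + norm ((p + v) * (p + v))"
    by (simp only: norm_triangle_ineq)
  also have "\<dots> \<le> 1 + 1"
    using assms by (intro add_mono norm_mult_le_1)
  finally show ?thesis
    by simp
qed

text \<open>The four scalars form a set closed under multiplication by the imaginary unit, so the
  condition can reproduce itself when \<open>w\<close> is rotated.\<close>

definition in_corner_ball :: "'x::unital_cstar_algebra \<Rightarrow> 'x \<Rightarrow> bool"
  where "in_corner_ball p w \<longleftrightarrow> p * w = w \<and> w * p = w \<and>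
    (\<forall>c\<in>{1, -1, \<i>, -\<i>}. norm (p + scaleC c w) \<le> 1)"

text \<open>
  Since \<open>(p + c w)\<^sup>2 + (p + \<i> c w)\<^sup>2 = 2 (p + (1 + \<i>) c w)\<close>, the ball condition survives multiplying
  \<open>w\<close> by \<open>1 + \<i>\<close>, whose modulus exceeds 1; iterating forces \<open>w = 0\<close>. This takes the place of
  spectral theory in the proof that projections with sum 1 are orthogonal.
\<close>

lemma in_corner_ball_rotate:
  fixes p :: "'x::unital_cstar_algebra"
  assumes p: "p * p = p" and w: "in_corner_ball p w"
  shows "in_corner_ball p (scaleC (1 + \<i>) w)"
proof -
  have corner: "p * w = w" "w * p = w"
    and ball: "\<And>c. c \<in> {1, -1, \<i>, -\<i>} \<Longrightarrow> norm (p + scaleC c w) \<le> 1"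
    using w by (auto simp: in_corner_ball_def)
  have step: "norm (p + scaleC c (scaleC (1 + \<i>) w)) \<le> 1" if "c \<in> {1, -1, \<i>, -\<i>}" for c
  proof -
    have "c * \<i> * (c * \<i>) = - (c * c)"
      by (simp add: algebra_simps)
    then have sq: "scaleC (c * \<i>) w * scaleC (c * \<i>) w = - (scaleC c w * scaleC c w)"
      by (simp add: mult_scaleC_left mult_scaleC_right scaleC_scaleC)
         (metis scaleC_scaleC scaleR_minus1_left scaleR_scaleC of_real_1 of_real_minus mult_minus1)
    have "norm (p + (scaleC c w + scaleC (c * \<i>) w)) \<le> 1"
      using that corner sq
      by (intro corner_ball_step p ball) (auto simp: mult_scaleC_left mult_scaleC_right)
    moreover have "scaleC c (scaleC (1 + \<i>) w) = scaleC c w + scaleC (c * \<i>) w"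
      by (simp add: scaleC_scaleC distrib_left flip: scaleC_add_left)
    ultimately show ?thesis
      by simp
  qed
  with corner show ?thesis
    by (simp add: in_corner_ball_def mult_scaleC_left mult_scaleC_right)
qed

lemma in_corner_ball_norm:
  fixes p :: "'x::unital_cstar_algebra"
  assumes p: "projection p" and w: "in_corner_ball p w"
  shows "norm w \<le> 2 / 2 ^ n"
  using w
proof (induction n arbitrary: w)
  case 0
  have "scaleC 1 w = w"
    using scaleR_scaleC[of 1 w] by simp
  then have "norm (p + w) \<le> 1"
    using 0 by (auto simp: in_corner_ball_def)
  then have "norm (p + w - p) \<le> 1 + 1"
    by (intro order_trans[OF norm_triangle_ineq4] add_mono norm_projection_le_1[OF p])
  then show ?case
    by simp
next
  case (Suc n)
  \<comment> \<open>Two rotations multiply \<open>w\<close> by 1 + i squared, that is 2i, so the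
    norm doubles while the bound stays; hence the factor 2 per induction step.\<close>
  have "in_corner_ball p (scaleC (1 + \<i>) (scaleC (1 + \<i>) w))"
    using p Suc.prems by (intro in_corner_ball_rotate) (auto simp: projection_def)
  then have "norm (scaleC (1 + \<i>) (scaleC (1 + \<i>) w)) \<le> 2 / 2 ^ n"
    by (rule Suc.IH)
  moreover have "(1 + \<i>) * (1 + \<i>) = 2 * \<i>"
    by (simp add: algebra_simps)
  ultimately show ?case
    by (simp add: scaleC_scaleC norm_scaleC norm_mult field_simps)
qed

text \<open>For self-adjoint \<open>d\<close> and c = i or -i, the product of \<open>p + c d\<close>
  with its adjoint is \<open>p + d * d\<close>, the mean of the squares of \<open>p + d\<close> and
  \<open>p - d\<close>. So the two real bounds yield the two imaginary ones, and
  \<open>in_corner_ball_norm\<close> applies for every \<open>n\<close>.\<close>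

lemma self_adjoint_corner_extreme:
  fixes p :: "'x::unital_cstar_algebra"
  assumes p: "projection p" and sa: "star d = d" and corner: "p * d = d" "d * p = d"
    and norms: "norm (p + d) \<le> 1" "norm (p - d) \<le> 1"
  shows "d = 0"
proof -
  have pp: "p * p = p" and ps: "star p = p"
    using p by (auto simp: projection_def)
  have one: "scaleC 1 x = x" "scaleC (-1) x = - x" for x :: 'x
    using scaleR_scaleC[of 1 x] scaleR_scaleC[of "-1" x] by simp_all
  have im: "norm (p + scaleC c d) \<le> 1" if c: "c \<in> {\<i>, -\<i>}" for c
  proof -
    have cc: "cnj c = - c" "c * c = -1"
      using c by auto
    have "scaleC c d * scaleC c d = - (d * d)"
      by (simp add: mult_scaleC_left mult_scaleC_right scaleC_scaleC cc one)
    moreover have "scaleC (- c) d = - scaleC c d"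
      by (metis one(2) mult_minus1 scaleC_scaleC)
    moreover have "p * scaleC c d = scaleC c d" "scaleC c d * p = scaleC c d"
      by (simp_all add: mult_scaleC_left mult_scaleC_right corner)
    ultimately have "2 *\<^sub>R (star (p + scaleC c d) * (p + scaleC c d)) = (p + d) * (p + d) + (p - d) * (p - d)"
      by (simp add: star_add star_scaleC sa ps cc algebra_simps pp corner scaleR_2)
    then have "norm (2 *\<^sub>R (star (p + scaleC c d) * (p + scaleC c d)))
        \<le> norm ((p + d) * (p + d)) + norm ((p - d) * (p - d))"
      by (simp only: norm_triangle_ineq)
    also have "\<dots> \<le> 1 + 1"
      by (intro add_mono norm_mult_le_1 norms)
    finally have "(norm (p + scaleC c d))\<^sup>2 \<le> 1"
      by (simp add: norm_star_mult)
    then show ?thesis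
      by (simp add: power_le_one_iff abs_square_le_1)
  qed
  have ball: "in_corner_ball p d"
    using corner norms im by (auto simp: in_corner_ball_def one)
  have "(\<lambda>n. 2 / 2 ^ n :: real) \<longlonglongrightarrow> 0"
    using tendsto_mult_right_zero[OF LIMSEQ_inverse_realpow_zero[of 2], of 2] by (simp add: divide_inverse)
  then have "norm d \<le> 0"
    by (rule LIMSEQ_le_const) (use in_corner_ball_norm[OF p ball] in auto)
  then show ?thesis
    by simp
qed

text \<open>Compressing the sum by \<open>p = q i\<close> shows that the terms other than
  \<open>q i\<close> compress to sum 0. This bounds a small multiple of \<open>p * q j * p\<close>
  on both sides of \<open>p\<close>, so it vanishes by extremality of \<open>p\<close>.\<close>

lemma projections_sum_1_orthogonal:
  fixes q :: "'i \<Rightarrow> 'x::unital_cstar_algebra"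
  assumes fin: "finite I" and proj: "\<And>i. i \<in> I \<Longrightarrow> projection (q i)" and sum1: "sum q I = 1"
    and ij: "i \<in> I" "j \<in> I" "i \<noteq> j"
  shows "q i * q j = 0"
proof -
  define p where "p = q i"
  define a where "a = p * q j * p"
  define R where "R = I - {i, j}"
  define m where "m = real (card R)"
  have p: "projection p" "projection (q j)" and pp: "p * p = p" and ps: "star p = p"
    and qq: "q j * q j = q j" and qs: "star (q j) = q j"
    using proj ij by (auto simp: p_def projection_def)
  have "(\<Sum>k\<in>I. p * q k * p) = p * sum q I * p"
    by (simp add: sum_distrib_left sum_distrib_right)
  also have "\<dots> = p"
    by (simp add: sum1 pp)
  also have "(\<Sum>k\<in>I. p * q k * p) = p * q i * p + (a + (\<Sum>k\<in>R. p * q k * p))"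
  proof -
    have I: "I = insert i (insert j R)" "i \<notin> insert j R" "j \<notin> R" "finite R"
      using fin ij by (auto simp: R_def)
    show ?thesis
      unfolding I(1) using I(2-4) by (simp add: a_def)
  qed
  finally have sumR: "(\<Sum>k\<in>R. p * q k * p) = - a"
    by (simp add: p_def[symmetric] pp) (metis add_eq_0_iff)
  \<comment> \<open>Norm estimates for compressed complements take the place of the order on
    self-adjoint elements.\<close>
  have "(\<Sum>k\<in>R. p * (1 - q k) * p) = m *\<^sub>R p + a"
    using sumR by (simp add: algebra_simps sum_subtractf pp m_def scaleR_conv_of_real)
  moreover have "norm (\<Sum>k\<in>R. p * (1 - q k) * p) \<le> m"
    unfolding m_def
    by (rule order_trans[OF sum_norm_le[where g = "\<lambda>_. 1"]])
      (auto simp: R_def intro!: norm_mult_projections_le_1 p projection_compl proj)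
  ultimately have nm: "norm (m *\<^sub>R p + a) \<le> m"
    by simp
  have "p - a = p * (1 - q j) * p"
    by (simp add: a_def algebra_simps pp)
  then have n1: "norm (p - a) \<le> 1"
    by (simp add: norm_mult_projections_le_1 p projection_compl)
  have mp: "norm (m *\<^sub>R p) \<le> m" "m \<ge> 0"
    using norm_projection_le_1[OF p(1)] by (auto simp: m_def mult_left_le)
  \<comment> \<open>With this scaling, \<open>m + 1\<close> times \<open>p + d\<close> and
    \<open>p - d\<close> split into the pieces bounded above, of norms adding up to at most
    \<open>m + 1\<close>.\<close>
  define d where "d = a /\<^sub>R (m + 1)"
  have ad: "a = (m + 1) *\<^sub>R d"
    using mp(2) by (simp add: d_def)
  have "norm ((m + 1) *\<^sub>R (p + d)) \<le> m + 1"
  proof -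
    have "(m + 1) *\<^sub>R (p + d) = p + (m *\<^sub>R p + a)"
      by (simp add: ad algebra_simps)
    then show ?thesis
      using norm_triangle_ineq[of p "m *\<^sub>R p + a"] nm norm_projection_le_1[OF p(1)] by simp
  qed
  moreover have "norm ((m + 1) *\<^sub>R (p - d)) \<le> m + 1"
  proof -
    have "(m + 1) *\<^sub>R (p - d) = m *\<^sub>R p + (p - a)"
      by (simp add: ad algebra_simps)
    then show ?thesis
      using norm_triangle_ineq[of "m *\<^sub>R p" "p - a"] n1 mp by simp
  qed
  ultimately have "norm (p + d) \<le> 1" "norm (p - d) \<le> 1"
    using mp(2) by (simp_all add: mult_le_cancel_left1)
  moreover have "star a = a"
    by (simp add: a_def star_mult ps qs mult.assoc)
  then have "star d = d"
    by (simp add: d_def star_scaleR)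
  moreover have "p * a = a"
    by (simp add: a_def pp flip: mult.assoc)
  then have "p * d = d"
    by (simp add: d_def)
  moreover have "a * p = a"
    by (simp add: a_def pp mult.assoc)
  then have "d * p = d"
    by (simp add: d_def)
  ultimately have "d = 0"
    using self_adjoint_corner_extreme p(1) by blast
  then have "p * q j * p = 0"
    using ad a_def by simp
  \<comment> \<open>The compression is the adjoint of \<open>q j * p\<close> times
    \<open>q j * p\<close>, so the C*-identity applies.\<close>
  then have "star (q j * p) * (q j * p) = 0"
    by (simp add: star_mult ps qs mult.assoc) (metis mult.assoc qq)
  then have "q j * p = 0"
    using norm_star_mult[of "q j * p"] by simp
  then have "star (q j * p) = 0"
    by simp
  then have "p * q j = 0"
    by (simp only: star_mult ps qs)
  then show ?thesis
    by (simp only: p_def)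
qed


section \<open>Connectedness through closed vertex sets\<close>

text \<open>Closed sets replace walks because level sets of harmonic functions and unions of
  components enter the argument in this form. Arcs with an end outside \<open>W\<close> are ignored,
  so deleting a vertex only shrinks \<open>W\<close>.\<close>

definition connected_on :: "'a set \<Rightarrow> 'a rel \<Rightarrow> bool"
  where "connected_on W E \<longleftrightarrow> W \<noteq> {} \<and>
    (\<forall>C\<subseteq>W. C \<noteq> {} \<longrightarrow> (\<forall>a\<in>C. \<forall>b\<in>W. (a, b) \<in> E \<longrightarrow> b \<in> C) \<longrightarrow> C = W)"

text \<open>Induction along a walk keeps it inside a closed set; conversely, the set of vertices
  reachable from a given one is closed.\<close>

lemma strongly_connected_iff_connected_on:
  "strongly_connected (with_proj P) \<longleftrightarrow> connected_on (pverts P) (parcs P)"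
proof
  assume sc: "strongly_connected (with_proj P)"
  have "b \<in> C" if "C \<subseteq> pverts P" "a \<in> C" "\<forall>a\<in>C. \<forall>b\<in>pverts P. (a, b) \<in> parcs P \<longrightarrow> b \<in> C"
    and b: "b \<in> pverts P" for C a b
  proof -
    have "(a, b) \<in> rtrancl_on (pverts P) (parcs P)"
      using sc that by (auto simp: strongly_connected_def reachable_def)
    then show ?thesis
      by (induct rule: rtrancl_on_induct) (use that in blast)+
  qed
  then have "C = pverts P"
    if "C \<subseteq> pverts P" "C \<noteq> {}" "\<forall>a\<in>C. \<forall>b\<in>pverts P. (a, b) \<in> parcs P \<longrightarrow> b \<in> C" for C
    using that by blast
  moreover have "pverts P \<noteq> {}"
    using sc by (simp add: strongly_connected_def)
  ultimately show "connected_on (pverts P) (parcs P)"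
    unfolding connected_on_def by blast
next
  assume conn: "connected_on (pverts P) (parcs P)"
  have "{b. (a, b) \<in> rtrancl_on (pverts P) (parcs P)} = pverts P" (is "?C = _") if "a \<in> pverts P" for a
  proof -
    have "?C \<subseteq> pverts P" "a \<in> ?C"
      using that by (auto dest: in_rtrancl_on_in_F)
    moreover have "\<forall>b\<in>?C. \<forall>c\<in>pverts P. (b, c) \<in> parcs P \<longrightarrow> c \<in> ?C"
      by (auto intro: rtrancl_on_into_rtrancl_on)
    ultimately show ?thesis
      using conn unfolding connected_on_def by blast
  qed
  with conn show "strongly_connected (with_proj P)"
    by (auto simp: strongly_connected_def reachable_def connected_on_def)
qed

lemma connected_on_cong:
  assumes "\<And>a b. a \<in> W \<Longrightarrow> b \<in> W \<Longrightarrow> (a, b) \<in> E \<longleftrightarrow> (a, b) \<in> F"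
  shows "connected_on W E \<longleftrightarrow> connected_on W F"
proof -
  have "(\<forall>a\<in>C. \<forall>b\<in>W. (a, b) \<in> E \<longrightarrow> b \<in> C) \<longleftrightarrow> (\<forall>a\<in>C. \<forall>b\<in>W. (a, b) \<in> F \<longrightarrow> b \<in> C)"
    if "C \<subseteq> W" for C
    using that assms by (meson subsetD)
  then show ?thesis
    unfolding connected_on_def by auto
qed

lemma pair_graph_sym: "pair_graph G \<Longrightarrow> sym (parcs G)"
  using pair_sym_digraph.pair_sym_arcs[of G]
  by (auto simp: pair_graph_def pair_pseudo_graph_def symmetric_def)

lemma connected_iff_connected_on:
  assumes "pair_graph G"
  shows "Digraph_Component.connected (with_proj G) \<longleftrightarrow> connected_on (pverts G) (parcs G)"
proof -
  have "parcs (mk_symmetric (with_proj G)) = parcs G"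
    using pair_graph_sym[OF assms] by (auto simp: parcs_mk_symmetric dest: symD)
  then show ?thesis
    by (simp add: connected_def strongly_connected_iff_connected_on)
qed

lemma connected_del_vert_iff_connected_on:
  assumes "pair_graph G"
  shows "Digraph_Component.connected (pre_digraph.del_vert (with_proj G) v) \<longleftrightarrow>
    connected_on (pverts G - {v}) (parcs G)"
  unfolding connected_def strongly_connected_iff_connected_on pverts_mk_symmetric
    pre_digraph.verts_del_vert with_proj_simps
  using pair_graph_sym[OF assms]
  by (intro connected_on_cong) (force simp: parcs_mk_symmetric pre_digraph.del_vert_simps dest: symD)

lemma two_connected_iff:
  assumes "pair_graph G"
  shows "two_connected G \<longleftrightarrow> connected_on (pverts G) (parcs G) \<and>
    (\<forall>v\<in>pverts G. connected_on (pverts G - {v}) (parcs G))"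
  using assms
  by (auto simp: two_connected_def connected_iff_connected_on connected_del_vert_iff_connected_on
      pre_digraph.verts_del_vert connected_on_def[of "_ - _"])

section \<open>Harmonic functions on a connected graph\<close>

text \<open>Maximum principle: the set where \<open>f\<close> attains its maximum is closed under
  arcs, hence all of \<open>W\<close>.\<close>

lemma real_harmonic_constant:
  fixes f :: "'a \<Rightarrow> real"
  assumes fin: "finite W" and conn: "connected_on W E"
    and harm: "\<And>c. c \<in> W \<Longrightarrow> (\<Sum>b\<in>{b\<in>W. (c, b) \<in> E}. f b - f c) = 0"
    and bc: "b \<in> W" "c \<in> W"
  shows "f b = f c"
proof -
  define M where "M = Max (f ` W)"
  define C where "C = {c \<in> W. f c = M}"
  have le: "f b \<le> M" if "b \<in> W" for b
    using fin that by (simp add: M_def)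
  have "M \<in> f ` W"
    using fin bc unfolding M_def by (intro Max_in) auto
  then have "C \<noteq> {}"
    by (auto simp: C_def)
  moreover have "b \<in> C" if "a \<in> C" "b \<in> W" "(a, b) \<in> E" for a b
  proof -
    have "(\<Sum>b\<in>{b\<in>W. (a, b) \<in> E}. M - f b) = 0"
      using harm[of a] that(1) by (simp add: C_def sum_subtractf)
    then have "\<forall>b\<in>{b\<in>W. (a, b) \<in> E}. M - f b = 0"
      using fin le by (subst (asm) sum_nonneg_eq_0_iff) auto
    with that show ?thesis
      by (auto simp: C_def)
  qed
  moreover have "C \<subseteq> W"
    by (auto simp: C_def)
  ultimately have "C = W"
    using conn unfolding connected_on_def by blast
  then have "b \<in> C" "c \<in> C"
    using bc by simp_all
  then show ?thesis
    by (simp add: C_def)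
qed

text \<open>Two different values would be separated by a real linear functional, whose composition
  with \<open>z\<close> is a real harmonic function.\<close>

lemma harmonic_constant:
  fixes z :: "'a \<Rightarrow> 'x::real_vector"
  assumes fin: "finite W" and conn: "connected_on W E"
    and harm: "\<And>c. c \<in> W \<Longrightarrow> (\<Sum>b\<in>{b\<in>W. (c, b) \<in> E}. z b - z c) = 0"
    and bc: "b \<in> W" "c \<in> W"
  shows "z b = z c"
proof (rule ccontr)
  assume "z b \<noteq> z c"
  then have "independent {z b - z c}"
    by simp
  then obtain g :: "'x \<Rightarrow> real" where g: "linear g" "g (z b - z c) = 1"
    using linear_independent_extend[of "{z b - z c}" "\<lambda>_. 1"] by auto
  have "(\<Sum>b\<in>{b\<in>W. (c, b) \<in> E}. g (z b) - g (z c)) = 0" if "c \<in> W" for c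
    using arg_cong[OF harm[OF that], of g] g(1) by (simp add: linear_sum linear_diff linear_0)
  then have "g (z b) = g (z c)"
    by (rule real_harmonic_constant[OF fin conn _ bc])
  with g show False
    by (simp add: linear_diff)
qed

section \<open>Transfer of connectedness along a quantum isomorphism\<close>

lemma quantum_isomorphism_intertwines:
  assumes "pair_graph G" "pair_graph H" and "quantum_isomorphism G H u"
    and "a \<in> pverts H" "c \<in> pverts G"
  shows "(\<Sum>b\<in>{b\<in>pverts G. (c, b) \<in> parcs G}. u a b) = (\<Sum>d\<in>{d\<in>pverts H. (a, d) \<in> parcs H}. u d c)"
proof -
  have fin: "finite (pverts G)" "finite (pverts H)"
    using assms(3) by (auto simp: quantum_isomorphism_def magic_unitary_def)
  have sym: "(b, c) \<in> parcs G \<longleftrightarrow> (c, b) \<in> parcs G" for b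
    using pair_graph_sym[OF assms(1)] by (auto dest: symD)
  have "(\<Sum>b\<in>pverts G. u a b * adj_matrix G b c) = (\<Sum>d\<in>pverts H. adj_matrix H a d * u d c)"
    using assms by (auto simp: quantum_isomorphism_def)
  then show ?thesis
    using fin by (simp add: adj_matrix_def if_distrib if_distribR sum.inter_filter sym cong: if_cong)
qed

text \<open>Stated for a general \<open>p\<close> to serve twice: \<open>p = 1\<close> with all
  vertices, and \<open>p = u v x\<close> with \<open>x\<close> and \<open>v\<close> removed. By
  \<open>block\<close>, sums of \<open>p * u a b\<close> over the full vertex sets may be restricted
  to \<open>W\<close> and \<open>W'\<close>.\<close>

lemma quantum_isomorphism_connected_on:
  fixes u :: "'b \<Rightarrow> 'a \<Rightarrow> 'x::unital_cstar_algebra"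
  assumes G: "pair_graph G" and H: "pair_graph H" and u: "quantum_isomorphism G H u"
    and p: "projection p" "p \<noteq> 0"
    and W: "W \<subseteq> pverts G" and W': "W' \<subseteq> pverts H"
    and block: "\<And>a b. a \<in> pverts H \<Longrightarrow> b \<in> pverts G \<Longrightarrow> (a \<in> W') \<noteq> (b \<in> W) \<Longrightarrow> p * u a b = 0"
    and conn: "connected_on W (parcs G)"
  shows "connected_on W' (parcs H)"
proof -
  have fin: "finite (pverts G)" "finite (pverts H)"
    and proj: "\<And>a b. a \<in> pverts H \<Longrightarrow> b \<in> pverts G \<Longrightarrow> projection (u a b)"
    and col: "\<And>b. b \<in> pverts G \<Longrightarrow> (\<Sum>a\<in>pverts H. u a b) = 1"
    and row: "\<And>a. a \<in> pverts H \<Longrightarrow> (\<Sum>b\<in>pverts G. u a b) = 1"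
    using u by (auto simp: quantum_isomorphism_def magic_unitary_def projection_def)
  have finW: "finite W" "finite W'"
    using fin W W' finite_subset by auto
  have row_orth: "u a b * u a c = 0" if "a \<in> pverts H" "b \<in> pverts G" "c \<in> pverts G" "b \<noteq> c" for a b c
    using projections_sum_1_orthogonal[of "pverts G" "u a" b c] that fin proj row by auto
  have col_orth: "u a c * u b c = 0" if "a \<in> pverts H" "b \<in> pverts H" "c \<in> pverts G" "a \<noteq> b" for a b c
    using projections_sum_1_orthogonal[of "pverts H" "\<lambda>a. u a c" a b] that fin proj col by auto
  have pp: "p * p = p" and ps: "star p = p"
    using p by (auto simp: projection_def)

  have rowW: "(\<Sum>b\<in>W. p * u a b) = p" if "a \<in> W'" for a
  proof -
    have "(\<Sum>b\<in>W. p * u a b) = (\<Sum>b\<in>pverts G. p * u a b)"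
      using W W' that block by (intro sum.mono_neutral_left fin) auto
    also have "\<dots> = p"
      using row[of a] W' that by (auto simp flip: sum_distrib_left)
    finally show ?thesis .
  qed
  have colW: "(\<Sum>a\<in>W'. p * u a b) = p" if "b \<in> W" for b
  proof -
    have "(\<Sum>a\<in>W'. p * u a b) = (\<Sum>a\<in>pverts H. p * u a b)"
      using W W' that block by (intro sum.mono_neutral_left fin) auto
    also have "\<dots> = p"
      using col[of b] W that by (auto simp flip: sum_distrib_left)
    finally show ?thesis .
  qed
  \<comment> \<open>\<open>p\<close> may fail to commute with the entries of \<open>u\<close>; the
    version with \<open>p\<close> on the right comes from taking adjoints.\<close>
  have rowW_right: "(\<Sum>b\<in>W. u a b) * p = p" if "a \<in> W'" for a
  proof -
    have "star (u a b) = u a b" if "b \<in> W" for b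
      using proj[of a b] \<open>a \<in> W'\<close> that W W' by (auto simp: projection_def)
    then have "star (\<Sum>b\<in>W. u a b) = (\<Sum>b\<in>W. u a b)"
      using finW(1) by (subst sum_comp_morphism[of star, symmetric, unfolded comp_def])
        (auto simp: star_add)
    then have "(\<Sum>b\<in>W. u a b) * p = star (p * (\<Sum>b\<in>W. u a b))"
      by (simp add: star_mult ps)
    also have "\<dots> = p"
      by (simp add: sum_distrib_left rowW[OF that] ps)
    finally show ?thesis .
  qed

  have inter: "(\<Sum>b\<in>{b\<in>W. (c, b) \<in> parcs G}. p * u a b) = (\<Sum>d\<in>{d\<in>W'. (a, d) \<in> parcs H}. p * u d c)"
    if "a \<in> W'" "c \<in> W" for a c
  proof -
    have "(\<Sum>b\<in>{b\<in>W. (c, b) \<in> parcs G}. p * u a b) = (\<Sum>b\<in>{b\<in>pverts G. (c, b) \<in> parcs G}. p * u a b)"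
      using W W' that block fin by (intro sum.mono_neutral_left) auto
    also have "\<dots> = (\<Sum>d\<in>{d\<in>pverts H. (a, d) \<in> parcs H}. p * u d c)"
      using quantum_isomorphism_intertwines[OF G H u, of a c] W W' that
      by (simp add: subset_iff flip: sum_distrib_left)
    also have "\<dots> = (\<Sum>d\<in>{d\<in>W'. (a, d) \<in> parcs H}. p * u d c)"
      using W W' that block fin by (intro sum.mono_neutral_right) auto
    finally show ?thesis .
  qed

  define deg where "deg c = real (card {b\<in>W. (c, b) \<in> parcs G})" for c
  define deg' where "deg' a = real (card {d\<in>W'. (a, d) \<in> parcs H})" for a
  have symG: "(b, c) \<in> parcs G \<longleftrightarrow> (c, b) \<in> parcs G" for b c
    using pair_graph_sym[OF G] by (auto dest: symD)
  have symH: "(b, c) \<in> parcs H \<longleftrightarrow> (c, b) \<in> parcs H" for b c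
    using pair_graph_sym[OF H] by (auto dest: symD)
  \<comment> \<open>Degrees are preserved: \<open>p * u a c\<close> vanishes wherever
    \<open>deg c\<close> and \<open>deg' a\<close> differ. This upgrades the intertwining of
    adjacency matrices to one of Laplacians.\<close>
  have degree: "deg c *\<^sub>R (p * u a c) = deg' a *\<^sub>R (p * u a c)" if ac: "a \<in> W'" "c \<in> W" for a c
  proof -
    have "(\<Sum>b\<in>W. deg b *\<^sub>R (p * u a b)) = (\<Sum>b\<in>W. \<Sum>c\<in>{c\<in>W. (c, b) \<in> parcs G}. p * u a b)"
      by (simp add: deg_def symG scaleR_conv_of_real)
    also have "\<dots> = (\<Sum>c\<in>W. \<Sum>b\<in>{b\<in>W. (c, b) \<in> parcs G}. p * u a b)"
      by (rule sum.swap_restrict) (use finW in auto)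
    also have "\<dots> = (\<Sum>c\<in>W. \<Sum>d\<in>{d\<in>W'. (a, d) \<in> parcs H}. p * u d c)"
      using inter ac by (intro sum.cong) auto
    also have "\<dots> = (\<Sum>d\<in>{d\<in>W'. (a, d) \<in> parcs H}. \<Sum>c\<in>W. p * u d c)"
      by (rule sum.swap)
    also have "\<dots> = deg' a *\<^sub>R p"
      by (simp add: rowW deg'_def scaleR_conv_of_real)
    finally have "(\<Sum>b\<in>W. deg b *\<^sub>R (p * u a b)) * u a c = deg' a *\<^sub>R p * u a c"
      by simp
    \<comment> \<open>Multiplying by \<open>u a c\<close> on the right picks out the term
      \<open>b = c\<close>, by orthogonality in row \<open>a\<close>.\<close>
    moreover have "(\<Sum>b\<in>W. deg b *\<^sub>R (p * u a b)) * u a c = (\<Sum>b\<in>W. if b = c then deg c *\<^sub>R (p * u a c) else 0)"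
      unfolding sum_distrib_right
      using ac W W' row_orth proj[of a c]
      by (intro sum.cong) (auto simp: mult.assoc projection_def subset_iff)
    ultimately show ?thesis
      using finW ac by simp
  qed

  have "C = W'" if C: "C \<subseteq> W'" "C \<noteq> {}" and closed: "\<And>a d. a \<in> C \<Longrightarrow> d \<in> W' \<Longrightarrow> (a, d) \<in> parcs H \<Longrightarrow> d \<in> C" for C
  proof (rule ccontr)
    assume "C \<noteq> W'"
    then obtain e e' where e: "e \<in> W'" "e \<notin> C" and e': "e' \<in> C"
      using C by auto
    have finC: "finite C"
      using C finW finite_subset by auto
    define z where "z b = (\<Sum>a\<in>C. p * u a b)" for b
    have harm: "(\<Sum>b\<in>{b\<in>W. (c, b) \<in> parcs G}. z b - z c) = 0" if c: "c \<in> W" for c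
    proof -
      have "(\<Sum>b\<in>{b\<in>W. (c, b) \<in> parcs G}. z b) = (\<Sum>a\<in>C. \<Sum>b\<in>{b\<in>W. (c, b) \<in> parcs G}. p * u a b)"
        unfolding z_def by (rule sum.swap)
      also have "\<dots> = (\<Sum>a\<in>C. \<Sum>d\<in>{d\<in>W'. (a, d) \<in> parcs H}. p * u d c)"
        using inter c C by (intro sum.cong) auto
      \<comment> \<open>Closedness of \<open>C\<close> keeps the neighbours of its vertices inside
        \<open>C\<close>.\<close>
      also have "\<dots> = (\<Sum>a\<in>C. \<Sum>d\<in>{d\<in>C. (a, d) \<in> parcs H}. p * u d c)"
        using C closed by (intro sum.cong) auto
      also have "\<dots> = (\<Sum>d\<in>C. \<Sum>a\<in>{a\<in>C. (a, d) \<in> parcs H}. p * u d c)"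
        by (rule sum.swap_restrict) (use finC in auto)
      also have "\<dots> = (\<Sum>d\<in>C. deg' d *\<^sub>R (p * u d c))"
      proof (intro sum.cong refl)
        fix d assume "d \<in> C"
        then have "{a\<in>C. (a, d) \<in> parcs H} = {a\<in>W'. (d, a) \<in> parcs H}"
          using C closed symH by blast
        then show "(\<Sum>a\<in>{a\<in>C. (a, d) \<in> parcs H}. p * u d c) = deg' d *\<^sub>R (p * u d c)"
          by (simp add: deg'_def scaleR_conv_of_real)
      qed
      also have "\<dots> = (\<Sum>d\<in>C. deg c *\<^sub>R (p * u d c))"
        using degree[OF subsetD[OF C(1)] c, symmetric] by (intro sum.cong) simp_all
      also have "\<dots> = deg c *\<^sub>R z c"
        by (simp add: z_def scaleR_sum_right)
      finally show ?thesis
        by (simp add: sum_subtractf deg_def scaleR_conv_of_real)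
    qed
    obtain w where w: "w \<in> W"
      using conn by (auto simp: connected_on_def)
    have const: "z b = z w" if "b \<in> W" for b
      by (rule harmonic_constant[OF finW(1) conn harm that w])
    \<comment> \<open>Orthogonality in column \<open>b\<close> makes \<open>z b\<close> act on
      \<open>u d b\<close> as \<open>p\<close> times the indicator of \<open>C\<close> at
      \<open>d\<close>.\<close>
    have zu: "z b * u d b = (if d \<in> C then p * u d b else 0)" if "b \<in> W" "d \<in> W'" for b d
    proof -
      have "z b * u d b = (\<Sum>a\<in>C. if a = d then p * u d b else 0)"
        unfolding z_def sum_distrib_right
        using that C W W' col_orth proj[of d b]
        by (intro sum.cong) (auto simp: mult.assoc projection_def subset_iff)
      then show ?thesis
        using finC by simp
    qed
    \<comment> \<open>Row \<open>d\<close> is inserted in front of \<open>p\<close>, and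
      \<open>z w\<close> is replaced by \<open>z b\<close> in each term. The left side is
      independent of \<open>d\<close>, so comparing \<open>d = e\<close> with \<open>d = e'\<close>
      forces \<open>p = 0\<close>.\<close>
    have zp: "z w * p = (if d \<in> C then p else 0)" if "d \<in> W'" for d
    proof -
      have "z w * p = (\<Sum>b\<in>W. z w * u d b) * p"
        using rowW_right[OF that] by (simp add: mult.assoc flip: sum_distrib_left)
      also have "(\<Sum>b\<in>W. z w * u d b) = (\<Sum>b\<in>W. if d \<in> C then p * u d b else 0)"
        using const zu that by (intro sum.cong) auto
      also have "\<dots> = (if d \<in> C then p else 0)"
        using rowW[OF that] by simp
      finally show ?thesis
        using pp by (simp split: if_splits)
    qed
    from zp[of e] zp[of e'] e e' C p(2) show False
      by auto
  qed
  \<comment> \<open>Were \<open>W'\<close> empty, a column sum in \<open>colW\<close> would be empty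
    and \<open>p\<close> would be 0.\<close>
  moreover have "W' \<noteq> {}"
    using conn colW p(2) by (auto simp: connected_on_def)
  ultimately show ?thesis
    unfolding connected_on_def by blast
qed

theorem theorem2p5:
  fixes G :: "'a pair_pre_digraph" and H :: "'b pair_pre_digraph"
  assumes "pair_graph G" and "pair_graph H"
    and "two_connected G"
    and "quantum_isomorphic TYPE('x::unital_cstar_algebra) G H"
  shows "two_connected H"
proof -
  obtain u :: "'b \<Rightarrow> 'a \<Rightarrow> 'x" where u: "quantum_isomorphism G H u"
    using assms(4) by (auto simp: quantum_isomorphic_def)
  have fin: "finite (pverts G)" "finite (pverts H)"
    and proj: "\<And>a b. a \<in> pverts H \<Longrightarrow> b \<in> pverts G \<Longrightarrow> projection (u a b)"
    and col: "\<And>b. b \<in> pverts G \<Longrightarrow> (\<Sum>a\<in>pverts H. u a b) = 1"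
    and row: "\<And>a. a \<in> pverts H \<Longrightarrow> (\<Sum>b\<in>pverts G. u a b) = 1"
    using u by (auto simp: quantum_isomorphism_def magic_unitary_def projection_def)
  have G: "connected_on (pverts G) (parcs G)"
    "\<And>x. x \<in> pverts G \<Longrightarrow> connected_on (pverts G - {x}) (parcs G)"
    using assms by (auto simp: two_connected_iff)
  have "connected_on (pverts H) (parcs H)"
    using quantum_isomorphism_connected_on[OF assms(1,2) u projection_1 _ order_refl order_refl _ G(1)]
    by auto
  moreover have "connected_on (pverts H - {v}) (parcs H)" if v: "v \<in> pverts H" for v
  proof -
    obtain x where x: "x \<in> pverts G" "u v x \<noteq> 0"
      using row[OF v] by (metis sum.neutral zero_neq_one)
    \<comment> \<open>Exactly one of \<open>a = v\<close> and \<open>b = x\<close> holds, so the two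
      entries are distinct and share row \<open>v\<close> or column \<open>x\<close>.\<close>
    have "u v x * u a b = 0"
      if "a \<in> pverts H" "b \<in> pverts G" "(a \<in> pverts H - {v}) \<noteq> (b \<in> pverts G - {x})" for a b
    proof (cases "a = v")
      case True
      with that show ?thesis
        using projections_sum_1_orthogonal[of "pverts G" "u v" x b] x v fin proj row by auto
    next
      case False
      with that show ?thesis
        using projections_sum_1_orthogonal[of "pverts H" "\<lambda>a. u a x" v a] x v fin proj col by auto
    qed
    then show ?thesis
      using quantum_isomorphism_connected_on[OF assms(1,2) u proj[OF v x(1)] x(2) _ _ _ G(2)[OF x(1)],
          of "pverts H - {v}"] by blast
  qed
  ultimately show ?thesis
    using assms(2) by (simp add: two_connected_iff)
qed

end
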